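(* Let $n\ge 2$ be an integer, let $\alpha_0,\dots,\alpha_n\in\mathbb{R}$, and let $f:[0,1]\to\mathbb{R}$ be a continuously differentiable function with $\int_0^1 x^kf(x)\,dx=\alpha_k$ for $k=0,1,\dots,n$. Then the range $f'([0,1])$ of the derivative contains the interval $[A_n,B_n]$, where $A_n=\min\{D_{k,n}: k=1,\dots,n\}$ and $B_n=\max\{D_{k,n}: k=1,\dots,n\}$. Moreover, $[A_n,B_n]\subseteq[A_{n+1},B_{n+1}]$ for all $n\ge 2$.
   Context: For a continuously differentiable function $f$ on $[0,1]$ and integers $1\le k\le n$, define $$D_{k,n}:=-\frac{\int_0^1 f(x)\,\frac{d}{dx}\bigl(x^k(1-x)^{n+1-k}\bigr)\,dx}{\int_0^1 x^k(1-x)^{n+1-k}\,dx}.$$ This number depends only on $k$, $n$ and the moments $\int_0^1x^jf(x)\,dx$, $j=0,\dots,n$. In the inclusion $[A_n,B_n]\subseteq[A_{n+1},B_{n+1}]$ all quantities are computed from the same function $f$. *)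

theory Defs
  imports "HOL-Analysis.Analysis"
begin

text \<open>Intended for \<open>1 \<le> k \<le> n\<close>, so the truncated subtraction \<open>n + 1 - k\<close> is the exact one.\<close>

definition mean_D :: "(real \<Rightarrow> real) \<Rightarrow> nat \<Rightarrow> nat \<Rightarrow> real" where
  "mean_D f k n =
     - (integral {0..1} (\<lambda>x. f x * deriv (\<lambda>t. t ^ k * (1 - t) ^ (n + 1 - k)) x)
        / integral {0..1} (\<lambda>x::real. x ^ k * (1 - x) ^ (n + 1 - k)))"

definition min_D :: "(real \<Rightarrow> real) \<Rightarrow> nat \<Rightarrow> real" where
  "min_D f n = Min ((\<lambda>k. mean_D f k n) ` {1..n})"

definition max_D :: "(real \<Rightarrow> real) \<Rightarrow> nat \<Rightarrow> real" where
  "max_D f n = Max ((\<lambda>k. mean_D f k n) ` {1..n})"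

end

theory Submission
  imports Defs
begin

text \<open>Write \<open>w\<^sub>k\<^sub>,\<^sub>n(x) = x\<^sup>k (1 - x)\<^bsup>n+1-k\<^esup>\<close>, which vanishes at both endpoints. Integration by parts shows
  that \<open>D\<^sub>k\<^sub>,\<^sub>n\<close> is the mean of \<open>f'\<close> with respect to the weight \<open>w\<^sub>k\<^sub>,\<^sub>n\<close>, so it lies between the
  extreme values of \<open>f'\<close>. Since \<open>x + (1 - x) = 1\<close> gives \<open>w\<^sub>k\<^sub>,\<^sub>n = w\<^sub>k\<^sub>,\<^sub>n\<^sub>+\<^sub>1 + w\<^sub>k\<^sub>+\<^sub>1\<^sub>,\<^sub>n\<^sub>+\<^sub>1\<close>, the mean
  \<open>D\<^sub>k\<^sub>,\<^sub>n\<close> is a convex combination of \<open>D\<^sub>k\<^sub>,\<^sub>n\<^sub>+\<^sub>1\<close> and \<open>D\<^sub>k\<^sub>+\<^sub>1\<^sub>,\<^sub>n\<^sub>+\<^sub>1\<close>.\<close>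

definition beta_weight :: "nat \<Rightarrow> nat \<Rightarrow> real \<Rightarrow> real" where
  "beta_weight k n x = x ^ k * (1 - x) ^ (n + 1 - k)"

lemma continuous_on_beta_weight [continuous_intros]: "continuous_on S (beta_weight k n)"
  unfolding beta_weight_def by (intro continuous_intros)

lemma beta_weight_nonneg: "x \<in> {0..1} \<Longrightarrow> 0 \<le> beta_weight k n x"
  unfolding beta_weight_def by simp

text \<open>A continuous nonnegative function with integral zero vanishes on the whole interval, but
  the weight is positive at 1/2.\<close>

lemma integral_beta_weight_pos: "0 < integral {0..1} (beta_weight k n)"
proof -
  have nonneg: "0 \<le> integral {0..1} (beta_weight k n)"
    by (intro Henstock_Kurzweil_Integration.integral_nonneg integrable_continuous_interval
        continuous_intros beta_weight_nonneg)
  have "integral {0..1} (beta_weight k n) \<noteq> 0"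
  proof
    assume "integral {0..1} (beta_weight k n) = 0"
    then have "\<forall>x\<in>{0..1}. beta_weight k n x = 0"
      using integral_eq_0_iff[of 0 1 "beta_weight k n"] beta_weight_nonneg
      by (simp add: continuous_on_beta_weight)
    then have "beta_weight k n (1/2) = 0" by simp
    then show False by (simp add: beta_weight_def)
  qed
  with nonneg show ?thesis by simp
qed

lemma beta_weight_split:
  "k \<le> n \<Longrightarrow> beta_weight k n x = beta_weight k (Suc n) x + beta_weight (Suc k) (Suc n) x"
  by (simp add: beta_weight_def Suc_diff_le algebra_simps)

lemma mean_D_eq_weighted_mean:
  fixes f f' :: "real \<Rightarrow> real"
  assumes deriv: "\<And>x. x \<in> {0..1} \<Longrightarrow> (f has_real_derivative f' x) (at x within {0..1})"
    and cont: "continuous_on {0..1} f'" and k: "1 \<le> k" "k \<le> n"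
  shows "mean_D f k n =
    integral {0..1} (\<lambda>x. beta_weight k n x * f' x) / integral {0..1} (beta_weight k n)"
proof -
  let ?w = "beta_weight k n"
  have eq: "(\<lambda>t. t ^ k * (1 - t) ^ (n + 1 - k)) = ?w"
    by (simp add: beta_weight_def fun_eq_iff)
  define w' where "w' x = real k * x ^ (k - 1) * (1 - x) ^ (n + 1 - k)
      - x ^ k * (real (n + 1 - k) * (1 - x) ^ (n + 1 - k - 1))" for x :: real
  \<comment> \<open>The derivative is two-sided, even at 0 and 1, to match the \<open>deriv\<close>
    in \<open>mean_D\<close>; for \<open>f\<close> the derivative within the interval is
    enough.\<close>
  have w': "(?w has_real_derivative w' x) (at x)" for x
    unfolding beta_weight_def w'_def
    by (rule derivative_eq_intros refl | simp)+
  have contf: "continuous_on {0..1} f"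
    using deriv by (rule DERIV_continuous_on)
  have "((\<lambda>x. f x * w' x + ?w x * f' x) has_integral f 1 * ?w 1 - f 0 * ?w 0) {0..1}"
  proof (rule fundamental_theorem_of_calculus)
    fix x :: real assume x: "x \<in> {0..1}"
    have "((\<lambda>x. f x * ?w x) has_real_derivative f x * w' x + ?w x * f' x) (at x within {0..1})"
      using DERIV_mult[OF deriv[OF x] DERIV_subset[OF w' subset_UNIV]]
      by (simp add: algebra_simps)
    then show "((\<lambda>x. f x * ?w x) has_vector_derivative f x * w' x + ?w x * f' x) (at x within {0..1})"
      by (simp add: has_real_derivative_iff_has_vector_derivative)
  qed simp
  \<comment> \<open>The range of \<open>k\<close> makes both exponents, \<open>k\<close> and
    \<open>n + 1 - k\<close>, positive, so the boundary terms of the integration by parts drop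
    out.\<close>
  moreover have "?w 0 = 0" "?w 1 = 0"
    using k by (simp_all add: beta_weight_def)
  ultimately have "integral {0..1} (\<lambda>x. f x * w' x + ?w x * f' x) = 0"
    by (simp add: integral_unique)
  moreover have "(\<lambda>x. f x * w' x) integrable_on {0..1}"
    unfolding w'_def by (intro integrable_continuous_interval continuous_intros contf)
  moreover have "(\<lambda>x. ?w x * f' x) integrable_on {0..1}"
    by (intro integrable_continuous_interval continuous_intros cont)
  ultimately have "integral {0..1} (\<lambda>x. f x * w' x) = - integral {0..1} (\<lambda>x. ?w x * f' x)"
    by (simp add: Henstock_Kurzweil_Integration.integral_add)
  then show ?thesis
    unfolding mean_D_def eq DERIV_imp_deriv[OF w'] by simp
qed

lemma weighted_mean_bounds:
  fixes g w :: "real \<Rightarrow> real"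
  assumes cont: "continuous_on {0..1} w" "continuous_on {0..1} g"
    and w: "\<And>x. x \<in> {0..1} \<Longrightarrow> 0 \<le> w x" "0 < integral {0..1} w"
    and g: "\<And>x. x \<in> {0..1} \<Longrightarrow> m \<le> g x \<and> g x \<le> M"
  shows "integral {0..1} (\<lambda>x. w x * g x) / integral {0..1} w \<in> {m..M}"
proof -
  have "integral {0..1} (\<lambda>x. w x * m) \<le> integral {0..1} (\<lambda>x. w x * g x)"
    "integral {0..1} (\<lambda>x. w x * g x) \<le> integral {0..1} (\<lambda>x. w x * M)"
    using w(1) g
    by (intro integral_le integrable_continuous_interval continuous_intros cont mult_left_mono; simp)+
  then show ?thesis
    using w(2) by (simp add: field_simps)
qed

text \<open>The mediant is the convex combination of \<open>a / c\<close> and \<open>b / d\<close>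
  with coefficients \<open>c / (c + d)\<close> and \<open>d / (c + d)\<close>.\<close>

lemma mediant_bounds:
  fixes a b c d :: real
  assumes "0 < c" "0 < d" "m \<le> a / c" "m \<le> b / d" "a / c \<le> M" "b / d \<le> M"
  shows "m \<le> (a + b) / (c + d)" "(a + b) / (c + d) \<le> M"
  using assms by (auto simp: field_simps intro: add_mono)

lemma mean_D_in_Suc_interval:
  fixes f f' :: "real \<Rightarrow> real"
  assumes deriv: "\<And>x. x \<in> {0..1} \<Longrightarrow> (f has_real_derivative f' x) (at x within {0..1})"
    and cont: "continuous_on {0..1} f'" and k: "1 \<le> k" "k \<le> n"
  shows "mean_D f k n \<in> {min_D f (Suc n)..max_D f (Suc n)}"
proof -
  let ?I = "\<lambda>k n. integral {0..1} (beta_weight k n)"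
  let ?J = "\<lambda>k n. integral {0..1} (\<lambda>x. beta_weight k n x * f' x)"
  note mean = mean_D_eq_weighted_mean[OF deriv cont]
  have I: "?I k n = ?I k (Suc n) + ?I (Suc k) (Suc n)"
    unfolding beta_weight_split[OF k(2), abs_def]
    by (intro Henstock_Kurzweil_Integration.integral_add integrable_continuous_interval
        continuous_intros)
  have J: "?J k n = ?J k (Suc n) + ?J (Suc k) (Suc n)"
    unfolding beta_weight_split[OF k(2)] distrib_right
    by (intro Henstock_Kurzweil_Integration.integral_add integrable_continuous_interval
        continuous_intros cont)
  \<comment> \<open>Needed for \<open>j = k\<close> and \<open>j = Suc k\<close>; both are
    admissible indices at level \<open>Suc n\<close> because \<open>k\<close> lies between 1 and
    \<open>n\<close>.\<close>
  have bounds: "min_D f (Suc n) \<le> ?J j (Suc n) / ?I j (Suc n)"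
    "?J j (Suc n) / ?I j (Suc n) \<le> max_D f (Suc n)" if "j \<in> {1..Suc n}" for j
    using that mean[of j "Suc n"] unfolding min_D_def max_D_def
    by (auto intro!: Min_le Max_ge image_eqI[where x = j])
  show ?thesis
    using mediant_bounds[of "?I k (Suc n)" "?I (Suc k) (Suc n)",
        OF integral_beta_weight_pos integral_beta_weight_pos bounds(1) bounds(1) bounds(2) bounds(2)] k
    unfolding mean[OF _ k, simplified] I J by simp
qed

theorem theorem4:
  fixes n :: nat and \<alpha> :: "nat \<Rightarrow> real" and f f' :: "real \<Rightarrow> real"
  assumes "n \<ge> 2"
    and "\<And>x. x \<in> {0..1} \<Longrightarrow> (f has_real_derivative f' x) (at x within {0..1})"
    and "continuous_on {0..1} f'"
    and "\<And>k. k \<le> n \<Longrightarrow> integral {0..1} (\<lambda>x. x ^ k * f x) = \<alpha> k"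
  shows "{min_D f n..max_D f n} \<subseteq> f' ` {0..1} \<and>
         (\<forall>m\<ge>2. {min_D f m..max_D f m} \<subseteq> {min_D f (m + 1)..max_D f (m + 1)})"
proof (intro conjI allI impI)
  \<comment> \<open>The index set is finite and nonempty, so both endpoints are themselves some
    \<open>mean_D f k m\<close>. Each inclusion below thus reduces to placing a single mean in an
    interval.\<close>
  have extremal: "min_D f m \<in> (\<lambda>k. mean_D f k m) ` {1..m}"
    "max_D f m \<in> (\<lambda>k. mean_D f k m) ` {1..m}" if "m \<ge> 2" for m
    using that unfolding min_D_def max_D_def by (auto intro!: Min_in Max_in)
  obtain a where a: "a \<in> {0..1}" "\<And>x. x \<in> {0..1} \<Longrightarrow> f' a \<le> f' x"
    using continuous_attains_inf[OF _ _ assms(3)] by auto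
  obtain b where b: "b \<in> {0..1}" "\<And>x. x \<in> {0..1} \<Longrightarrow> f' x \<le> f' b"
    using continuous_attains_sup[OF _ _ assms(3)] by auto
  \<comment> \<open>Intermediate values: a connected set of reals containing the extreme values of
    \<open>f'\<close> contains everything between them.\<close>
  have "connected (f' ` {0..1})"
    using assms(3) by (intro connected_continuous_image) auto
  then have "{f' a..f' b} \<subseteq> f' ` {0..1}"
    using a(1) b(1) by (intro connected_contains_Icc) auto
  moreover have "mean_D f k n \<in> {f' a..f' b}" if "k \<in> {1..n}" for k
    using that a b mean_D_eq_weighted_mean[OF assms(2,3), of k n]
      weighted_mean_bounds[OF continuous_on_beta_weight assms(3) beta_weight_nonneg
        integral_beta_weight_pos, of "f' a" "f' b" k n]
    by simp
  then have "{min_D f n..max_D f n} \<subseteq> {f' a..f' b}"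
    using extremal[OF assms(1)] by fastforce
  ultimately show "{min_D f n..max_D f n} \<subseteq> f' ` {0..1}" by blast
  fix m :: nat assume "m \<ge> 2"
  then show "{min_D f m..max_D f m} \<subseteq> {min_D f (m + 1)..max_D f (m + 1)}"
    using extremal[of m] mean_D_in_Suc_interval[OF assms(2,3), of _ m] by fastforce
qed

end
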